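(* The structures $\langle\mathcal P(\omega)/\mathrm{Fin},\sigma\rangle$ and $\langle\mathcal P(\omega)/\mathrm{Fin},\sigma^{-1}\rangle$ are elementarily equivalent in the language of dynamical systems.
   Context: $\mathcal P(\omega)/\mathrm{Fin}$ is $\mathcal P(\omega)$ modulo finite sets, $\sigma([A])=[A+1]$ the shift. The language of dynamical systems is the first-order language with constants $\mathbf 0,\mathbf 1$, binary operations for join, meet and difference, the relation $\le$, and unary function symbols interpreted as an automorphism and its inverse. Elementarily equivalent means satisfying the same parameter-free first-order sentences. (No set-theoretic hypothesis beyond ZFC is assumed.) *)

theory Defs
  imports Main
begin

section \<open>The Boolean algebra of subsets of the naturals modulo finite sets\<close>

definition almost_eq :: "nat set \<Rightarrow> nat set \<Rightarrow> bool" where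
  "almost_eq A B \<longleftrightarrow> finite ((A - B) \<union> (B - A))"

lemma equivp_almost_eq: "equivp almost_eq"
proof (rule equivpI)
  show "reflp almost_eq" by (simp add: reflp_def almost_eq_def)
  show "symp almost_eq" by (simp add: symp_def almost_eq_def)
  show "transp almost_eq"
    unfolding transp_def almost_eq_def
  proof (intro allI impI)
    fix A B C :: "nat set"
    assume "finite ((A - B) \<union> (B - A))" "finite ((B - C) \<union> (C - B))"
    then show "finite ((A - C) \<union> (C - A))"
      by (rule_tac finite_subset[of _ "((A - B) \<union> (B - A)) \<union> ((B - C) \<union> (C - B))"]) auto
  qed
qed

quotient_type pomega_fin = "nat set" / almost_eq
  morphisms rep_pomega_fin cls
  by (rule equivp_almost_eq)

instantiation pomega_fin :: boolean_algebra
begin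

lift_definition bot_pomega_fin :: pomega_fin is "{}" .

lift_definition top_pomega_fin :: pomega_fin is UNIV .

lift_definition sup_pomega_fin :: "pomega_fin \<Rightarrow> pomega_fin \<Rightarrow> pomega_fin" is "(\<union>)"
  unfolding almost_eq_def
  subgoal for A A' B B'
    by (rule finite_subset[of _ "((A - A') \<union> (A' - A)) \<union> ((B - B') \<union> (B' - B))"]) auto
  done

lift_definition inf_pomega_fin :: "pomega_fin \<Rightarrow> pomega_fin \<Rightarrow> pomega_fin" is "(\<inter>)"
  unfolding almost_eq_def
  subgoal for A A' B B'
    by (rule finite_subset[of _ "((A - A') \<union> (A' - A)) \<union> ((B - B') \<union> (B' - B))"]) auto
  done

lift_definition minus_pomega_fin :: "pomega_fin \<Rightarrow> pomega_fin \<Rightarrow> pomega_fin" is "(-)"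
  unfolding almost_eq_def
  subgoal for A A' B B'
    by (rule finite_subset[of _ "((A - A') \<union> (A' - A)) \<union> ((B - B') \<union> (B' - B))"]) auto
  done

lift_definition uminus_pomega_fin :: "pomega_fin \<Rightarrow> pomega_fin" is uminus
  unfolding almost_eq_def
  subgoal for A A'
    by (rule finite_subset[of _ "(A - A') \<union> (A' - A)"]) auto
  done

lift_definition less_eq_pomega_fin :: "pomega_fin \<Rightarrow> pomega_fin \<Rightarrow> bool" is
  "\<lambda>A B. finite (A - B)"
  unfolding almost_eq_def
  subgoal for A A' B B'
    by (rule iffI;
        rule finite_subset[of _ "(A - B) \<union> ((A - A') \<union> (A' - A)) \<union> ((B - B') \<union> (B' - B))"]
             finite_subset[of _ "(A' - B') \<union> ((A - A') \<union> (A' - A)) \<union> ((B - B') \<union> (B' - B))"],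
        force, blast)
  done

definition less_pomega_fin :: "pomega_fin \<Rightarrow> pomega_fin \<Rightarrow> bool" where
  "less_pomega_fin x y \<longleftrightarrow> x \<le> y \<and> \<not> y \<le> x"

instance
proof
  fix x y z :: pomega_fin
  show "(x < y) = (x \<le> y \<and> \<not> y \<le> x)" by (rule less_pomega_fin_def)
  show "x \<le> x" by transfer simp
  show "x \<le> y \<Longrightarrow> y \<le> z \<Longrightarrow> x \<le> z"
  proof transfer
    fix A B C :: "nat set"
    assume "finite (A - B)" "finite (B - C)"
    then show "finite (A - C)"
      by (rule_tac finite_subset[of _ "(A - B) \<union> (B - C)"]) auto
  qed
  show "x \<le> y \<Longrightarrow> y \<le> x \<Longrightarrow> x = y" by transfer (simp add: almost_eq_def)
  show "inf x y \<le> x" by transfer (rule finite_subset[of _ "{}"]; auto)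
  show "inf x y \<le> y" by transfer (rule finite_subset[of _ "{}"]; auto)
  show "x \<le> y \<Longrightarrow> x \<le> z \<Longrightarrow> x \<le> inf y z" by transfer (simp add: Diff_Int)
  show "x \<le> sup x y" by transfer (rule finite_subset[of _ "{}"]; auto)
  show "y \<le> sup x y" by transfer (rule finite_subset[of _ "{}"]; auto)
  show "y \<le> x \<Longrightarrow> z \<le> x \<Longrightarrow> sup y z \<le> x" by transfer (simp add: Un_Diff)
  show "bot \<le> x" by transfer simp
  show "x \<le> top" by transfer simp
  show "sup x (inf y z) = inf (sup x y) (sup x z)"
    by transfer (simp add: Un_Int_distrib almost_eq_def)
  show "inf x (- x) = bot" by transfer (simp add: almost_eq_def)
  show "sup x (- x) = top" by transfer (simp add: almost_eq_def)
  show "x - y = inf x (- y)" by transfer (simp add: Diff_eq almost_eq_def)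
qed

end


section \<open>The shift automorphism\<close>

lift_definition shift :: "pomega_fin \<Rightarrow> pomega_fin" is "\<lambda>A. Suc ` A"
  unfolding almost_eq_def
  subgoal for A B
    by (rule finite_subset[of _ "Suc ` ((A - B) \<union> (B - A))"]) auto
  done

lemma shift_le_iff: "shift x \<le> shift y \<longleftrightarrow> x \<le> y"
proof transfer
  fix A B :: "nat set"
  have "Suc ` A - Suc ` B = Suc ` (A - B)" by auto
  then show "finite (Suc ` A - Suc ` B) \<longleftrightarrow> finite (A - B)"
    by (simp add: finite_image_iff)
qed

lemma shift_cls_vimage: "shift (cls (Suc -` A)) = cls A"
proof -
  have "almost_eq (Suc ` (Suc -` A)) A"
    unfolding almost_eq_def
  proof (rule finite_subset[of _ "{0}"])
    show "(Suc ` (Suc -` A) - A) \<union> (A - Suc ` (Suc -` A)) \<subseteq> {0}"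
    proof
      fix n assume "n \<in> (Suc ` (Suc -` A) - A) \<union> (A - Suc ` (Suc -` A))"
      then show "n \<in> {0}" by (cases n) auto
    qed
  qed simp
  then show ?thesis
    by (simp add: shift.abs_eq pomega_fin.abs_eq_iff)
qed

lemma bij_shift: "bij shift"
proof (rule bijI)
  show "inj shift"
    by (rule injI) (metis order_antisym order_refl shift_le_iff)
  show "surj shift"
  proof (rule surjI)
    fix y
    show "shift (cls (Suc -` rep_pomega_fin y)) = y"
      by (simp add: shift_cls_vimage Quotient_abs_rep[OF Quotient_pomega_fin])
  qed
qed

lemma inv_shift_cls: "inv shift (cls A) = cls (Suc -` A)"
  by (metis bij_shift bij_is_inj inv_f_f shift_cls_vimage)


section \<open>The first-order language of dynamical systems\<close>

datatype tm =
    Var nat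
  | Zero
  | One
  | Join tm tm
  | Meet tm tm
  | Diff tm tm
  | Aut tm
  | AutInv tm

datatype fm =
    Eq tm tm
  | Le tm tm
  | Neg fm
  | Conj fm fm
  | Exist nat fm

fun tm_vars :: "tm \<Rightarrow> nat set" where
  "tm_vars (Var n) = {n}"
| "tm_vars Zero = {}"
| "tm_vars One = {}"
| "tm_vars (Join s t) = tm_vars s \<union> tm_vars t"
| "tm_vars (Meet s t) = tm_vars s \<union> tm_vars t"
| "tm_vars (Diff s t) = tm_vars s \<union> tm_vars t"
| "tm_vars (Aut t) = tm_vars t"
| "tm_vars (AutInv t) = tm_vars t"

fun free_vars :: "fm \<Rightarrow> nat set" where
  "free_vars (Eq s t) = tm_vars s \<union> tm_vars t"
| "free_vars (Le s t) = tm_vars s \<union> tm_vars t"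
| "free_vars (Neg p) = free_vars p"
| "free_vars (Conj p q) = free_vars p \<union> free_vars q"
| "free_vars (Exist n p) = free_vars p - {n}"

definition sentence :: "fm \<Rightarrow> bool" where
  "sentence p \<longleftrightarrow> free_vars p = {}"

text \<open>
  A dynamical system is a Boolean algebra, here a type of class
  \<^class>\<open>boolean_algebra\<close>, together with an automorphism \<open>f\<close>; the algebra is
  recovered from the type of \<open>f\<close>. The second unary symbol denotes \<open>inv f\<close>, which
  is the inverse map only when \<open>f\<close> is a bijection.
\<close>

fun tm_val :: "('a::boolean_algebra \<Rightarrow> 'a) \<Rightarrow> (nat \<Rightarrow> 'a) \<Rightarrow> tm \<Rightarrow> 'a" where
  "tm_val f e (Var n) = e n"
| "tm_val f e Zero = bot"
| "tm_val f e One = top"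
| "tm_val f e (Join s t) = sup (tm_val f e s) (tm_val f e t)"
| "tm_val f e (Meet s t) = inf (tm_val f e s) (tm_val f e t)"
| "tm_val f e (Diff s t) = tm_val f e s - tm_val f e t"
| "tm_val f e (Aut t) = f (tm_val f e t)"
| "tm_val f e (AutInv t) = inv f (tm_val f e t)"

fun sat :: "('a::boolean_algebra \<Rightarrow> 'a) \<Rightarrow> (nat \<Rightarrow> 'a) \<Rightarrow> fm \<Rightarrow> bool" where
  "sat f e (Eq s t) \<longleftrightarrow> tm_val f e s = tm_val f e t"
| "sat f e (Le s t) \<longleftrightarrow> tm_val f e s \<le> tm_val f e t"
| "sat f e (Neg p) \<longleftrightarrow> \<not> sat f e p"
| "sat f e (Conj p q) \<longleftrightarrow> sat f e p \<and> sat f e q"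
| "sat f e (Exist n p) \<longleftrightarrow> (\<exists>a. sat f (e(n := a)) p)"

text \<open>For a sentence the choice of assignment is immaterial.\<close>

lemma tm_val_cong: "(\<And>n. n \<in> tm_vars t \<Longrightarrow> e n = e' n) \<Longrightarrow> tm_val f e t = tm_val f e' t"
  by (induction t) auto

lemma sat_cong: "(\<And>n. n \<in> free_vars p \<Longrightarrow> e n = e' n) \<Longrightarrow> sat f e p \<longleftrightarrow> sat f e' p"
proof (induction p arbitrary: e e')
  case (Eq s t)
  then show ?case using tm_val_cong[of s e e' f] tm_val_cong[of t e e' f] by simp
next
  case (Le s t)
  then show ?case using tm_val_cong[of s e e' f] tm_val_cong[of t e e' f] by simp
next
  case (Neg p)
  then show ?case by (metis free_vars.simps(3) sat.simps(3))
next
  case (Conj p q)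
  then show ?case by (metis UnCI free_vars.simps(4) sat.simps(4))
next
  case (Exist n p)
  have "sat f (e(n := a)) p \<longleftrightarrow> sat f (e'(n := a)) p" for a
    by (rule Exist.IH) (use Exist.prems in auto)
  then show ?case by simp
qed

definition holds :: "('a::boolean_algebra \<Rightarrow> 'a) \<Rightarrow> fm \<Rightarrow> bool" where
  "holds f p \<longleftrightarrow> (\<forall>e. sat f e p)"

lemma holds_iff_sat: "sentence p \<Longrightarrow> holds f p \<longleftrightarrow> sat f e p"
  unfolding holds_def sentence_def by (metis empty_iff sat_cong)

definition elementarily_equivalent ::
    "('a::boolean_algebra \<Rightarrow> 'a) \<Rightarrow> ('b::boolean_algebra \<Rightarrow> 'b) \<Rightarrow> bool" where
  "elementarily_equivalent f g \<longleftrightarrow> (\<forall>p. sentence p \<longrightarrow> (holds f p \<longleftrightarrow> holds g p))"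

end

(* A finite tuple of subsets of the naturals is an infinite word, and an assignment modulo Fin
   only sees its tail. Call finite words rank-k equivalent if they cannot be told apart by a
   k-round game in which a round changes one coordinate of the letters and the final comparison
   looks at the ends and the short factors. This is a congruence of finite index, so by Ramsey's
   theorem every infinite word splits into blocks of a single idempotent class e. If w splits
   into blocks of class e, and so does v after each of its blocks is reversed, then w under the
   shift and v under the inverse shift satisfy the same formulas of rank k: in answer to a change
   of w, regroup the new blocks of w by Ramsey into a class f, and change each block of v
   separately so that it gets class f as well. The constant word starts the game, being its own
   reversal. *)

theory Submission
  imports Defs "HOL-Library.Ramsey" "HOL-Library.Sublist"
begin

section \<open>Depth, variables and quantifier rank of formulas\<close>

fun depth :: "tm \<Rightarrow> nat" where
  "depth (Var n) = 0"
| "depth Zero = 0"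
| "depth One = 0"
| "depth (Join s t) = max (depth s) (depth t)"
| "depth (Meet s t) = max (depth s) (depth t)"
| "depth (Diff s t) = max (depth s) (depth t)"
| "depth (Aut t) = Suc (depth t)"
| "depth (AutInv t) = Suc (depth t)"

text \<open>\<open>d\<close> bounds how far a term looks from a position, \<open>N\<close> all
  variables including the bound ones, and \<open>k\<close> the nesting of quantifiers, that is, the
  number of rounds.\<close>

fun bounded_fm :: "nat \<Rightarrow> nat \<Rightarrow> nat \<Rightarrow> fm \<Rightarrow> bool" where
  "bounded_fm d N k (Eq s t) \<longleftrightarrow> depth s \<le> d \<and> depth t \<le> d \<and> tm_vars s \<union> tm_vars t \<subseteq> {..<N}"
| "bounded_fm d N k (Le s t) \<longleftrightarrow> depth s \<le> d \<and> depth t \<le> d \<and> tm_vars s \<union> tm_vars t \<subseteq> {..<N}"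
| "bounded_fm d N k (Neg p) \<longleftrightarrow> bounded_fm d N k p"
| "bounded_fm d N k (Conj p q) \<longleftrightarrow> bounded_fm d N k p \<and> bounded_fm d N k q"
| "bounded_fm d N k (Exist n p) \<longleftrightarrow> n < N \<and> (\<exists>k'. k = Suc k' \<and> bounded_fm d N k' p)"

lemma bounded_fm_mono:
  "bounded_fm d N k p \<Longrightarrow> d \<le> d' \<Longrightarrow> N \<le> N' \<Longrightarrow> k \<le> k' \<Longrightarrow> bounded_fm d' N' k' p"
proof (induction p arbitrary: k k')
  case (Exist n p)
  then show ?case by (cases k') auto
qed fastforce+

lemma finite_tm_vars: "finite (tm_vars t)"
  by (induction t) auto

lemma ex_bounded_fm: "\<exists>d N k. bounded_fm d N k p"
proof (induction p)
  case (Eq s t)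
  obtain N where "tm_vars s \<union> tm_vars t \<subseteq> {..<N}"
    using finite_nat_iff_bounded[of "tm_vars s \<union> tm_vars t"] finite_tm_vars by auto
  then have "bounded_fm (max (depth s) (depth t)) N 0 (Eq s t)" by simp
  then show ?case by blast
next
  case (Le s t)
  obtain N where "tm_vars s \<union> tm_vars t \<subseteq> {..<N}"
    using finite_nat_iff_bounded[of "tm_vars s \<union> tm_vars t"] finite_tm_vars by auto
  then have "bounded_fm (max (depth s) (depth t)) N 0 (Le s t)" by simp
  then show ?case by blast
next
  case (Conj p q)
  then obtain d N k d' N' k' where "bounded_fm d N k p" "bounded_fm d' N' k' q" by blast
  then have "bounded_fm (max d d') (max N N') (max k k') (Conj p q)"
    by (auto elim: bounded_fm_mono)
  then show ?case by blast
next
  case (Exist n p)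
  then obtain d N k where "bounded_fm d N k p" by blast
  then have "bounded_fm d (max N (Suc n)) (Suc k) (Exist n p)"
    by (auto elim: bounded_fm_mono)
  then show ?case by blast
qed auto


section \<open>Equivalence of finite words up to a quantifier rank\<close>

text \<open>A finite tuple of sets of naturals is read as an infinite word: the letter at position
  \<open>i\<close> is the set of those variables whose value contains \<open>i\<close>.\<close>

type_synonym letter = "nat set"

text \<open>A move of the game: the value of variable \<open>n\<close> may be chosen anew at every
  position, while the other coordinates stay.\<close>

definition variant :: "nat \<Rightarrow> letter list \<Rightarrow> letter list \<Rightarrow> bool" where
  "variant n = list_all2 (\<lambda>a b. b - {n} = a - {n})"

lemma variant_append:
  "variant n (u @ v) z \<longleftrightarrow> (\<exists>u' v'. z = u' @ v' \<and> variant n u u' \<and> variant n v v')"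
  unfolding variant_def list_all2_append1 using list_all2_lengthD by metis

lemma finite_range_kernel:
  assumes "\<And>u v. R u v \<longleftrightarrow> F u = F v" and "finite (range F)"
  shows "finite (range (\<lambda>u. Collect (R u)))"
proof -
  have "range (\<lambda>u. Collect (R u)) \<subseteq> (\<lambda>x. {v. x = F v}) ` range F"
    using assms(1) by auto
  then show ?thesis using assms(2) finite_surj by blast
qed

context
  fixes d N :: nat
begin

text \<open>Cutting letters to the variables below \<open>N\<close> leaves a finite alphabet, on
  which the finite index rests.\<close>

abbreviation restr :: "letter list \<Rightarrow> letter list" where
  "restr \<equiv> map (\<lambda>a. a \<inter> {..<N})"

text \<open>Length \<open>Suc (2 * d)\<close> is that of a window of radius \<open>d\<close> around
  a position, all that a term of depth at most \<open>d\<close> sees.\<close>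

definition factors :: "letter list \<Rightarrow> letter list set" where
  "factors u = {f. length f = Suc (2 * d) \<and> sublist f (restr u)}"

text \<open>Both ends are recorded, the last letters in reverse order, because they determine the
  factors that straddle the seam of a concatenation.\<close>

definition local_type :: "letter list \<Rightarrow> letter list \<times> letter list \<times> letter list set" where
  "local_type u = (take (Suc (2 * d)) (restr u), take (Suc (2 * d)) (rev (restr u)), factors u)"

text \<open>Back-and-forth is encoded as equality of the sets of rank \<open>k\<close> classes that
  one move reaches; this exhibits the relation as the kernel of a map.\<close>

primrec rk_eq :: "nat \<Rightarrow> letter list \<Rightarrow> letter list \<Rightarrow> bool" where
  "rk_eq 0 = (\<lambda>u v. local_type u = local_type v)"
| "rk_eq (Suc k) = (\<lambda>u v. rk_eq k u v \<and>
     {(n, Collect (rk_eq k u')) | n u'. n < N \<and> variant n u u'} =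
     {(n, Collect (rk_eq k v')) | n v'. n < N \<and> variant n v v'})"

lemma rk_eq_equivp: "equivp (rk_eq k)"
proof (induction k)
  case 0
  then show ?case by (auto intro!: equivpI reflpI sympI transpI)
next
  case (Suc k)
  show ?case
    unfolding rk_eq.simps
    by (intro equivpI reflpI sympI transpI)
      (use equivp_reflp[OF Suc] equivp_symp[OF Suc] equivp_transp[OF Suc] in metis)+
qed

lemmas rk_eq_refl [simp] = equivp_reflp[OF rk_eq_equivp]
lemmas rk_eq_sym = equivp_symp[OF rk_eq_equivp]
lemmas rk_eq_trans [trans] = equivp_transp[OF rk_eq_equivp]

lemma Collect_rk_eq_iff: "Collect (rk_eq k u) = Collect (rk_eq k v) \<longleftrightarrow> rk_eq k u v"
  using rk_eq_equivp[of k] by (auto simp: equivp_def)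

lemma rk_eq_SucI:
  assumes "rk_eq k u v"
    and "\<And>n u'. n < N \<Longrightarrow> variant n u u' \<Longrightarrow> \<exists>v'. variant n v v' \<and> rk_eq k u' v'"
    and "\<And>n v'. n < N \<Longrightarrow> variant n v v' \<Longrightarrow> \<exists>u'. variant n u u' \<and> rk_eq k u' v'"
  shows "rk_eq (Suc k) u v"
proof -
  have "{(n, Collect (rk_eq k u')) | n u'. n < N \<and> variant n u u'} =
     {(n, Collect (rk_eq k v')) | n v'. n < N \<and> variant n v v'}" (is "?L = ?R")
  proof (rule set_eqI)
    fix x
    show "x \<in> ?L \<longleftrightarrow> x \<in> ?R"
    proof
      assume "x \<in> ?L"
      then obtain n u' where x: "x = (n, Collect (rk_eq k u'))" "n < N" "variant n u u'" by blast
      then obtain v' where "variant n v v'" "rk_eq k u' v'" using assms(2) by blast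
      then show "x \<in> ?R" using x Collect_rk_eq_iff by blast
    next
      assume "x \<in> ?R"
      then obtain n v' where x: "x = (n, Collect (rk_eq k v'))" "n < N" "variant n v v'" by blast
      then obtain u' where "variant n u u'" "rk_eq k u' v'" using assms(3) by blast
      then show "x \<in> ?L" using x Collect_rk_eq_iff by blast
    qed
  qed
  with assms(1) show ?thesis unfolding rk_eq.simps by (rule conjI)
qed

lemma rk_eq_SucD:
  assumes "rk_eq (Suc k) u v" "n < N" "variant n u u'"
  obtains v' where "variant n v v'" "rk_eq k u' v'"
proof -
  have "(n, Collect (rk_eq k u')) \<in> {(n, Collect (rk_eq k u')) | n u'. n < N \<and> variant n u u'}"
    using assms(2,3) by blast
  then have "(n, Collect (rk_eq k u')) \<in> {(n, Collect (rk_eq k v')) | n v'. n < N \<and> variant n v v'}"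
    using assms(1) by (simp only: rk_eq.simps)
  then show thesis using that Collect_rk_eq_iff by auto
qed

lemma rk_eq_imp_local_type: "rk_eq k u v \<Longrightarrow> local_type u = local_type v"
  by (induction k) auto

text \<open>Words of bounded length over a finite alphabet leave finitely many local types. A class
  of rank \<open>Suc k\<close> is fixed by its class of rank \<open>k\<close> and a set of pairs of
  a variable and such a class.\<close>

lemma finite_classes: "finite (range (\<lambda>u. Collect (rk_eq k u)))"
proof (induction k)
  case 0
  let ?W = "{u. set u \<subseteq> Pow {..<N} \<and> length u \<le> Suc (2 * d)}"
  have fin: "finite ?W" by (rule finite_lists_length_le) simp
  have "sublist f (restr u) \<Longrightarrow> set f \<subseteq> Pow {..<N}" for f u
    using set_mono_sublist by fastforce
  then have "range local_type \<subseteq> ?W \<times> ?W \<times> Pow ?W"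
    by (auto simp: local_type_def factors_def dest!: in_set_takeD)
  then have "finite (range local_type)"
    by (rule finite_subset) (use fin in simp)
  then show ?case by (intro finite_range_kernel[where F = local_type]) auto
next
  case (Suc k)
  let ?C = "range (\<lambda>u. Collect (rk_eq k u))"
  let ?F = "\<lambda>u. (Collect (rk_eq k u), {(n, Collect (rk_eq k u')) | n u'. n < N \<and> variant n u u'})"
  have "range ?F \<subseteq> ?C \<times> Pow ({..<N} \<times> ?C)" by auto
  then have "finite (range ?F)"
    by (rule finite_subset) (use Suc in simp)
  then show ?case by (intro finite_range_kernel[where F = ?F]) (auto simp: Collect_rk_eq_iff)
qed

text \<open>A factor across the seam is a suffix of \<open>restr u\<close> followed by a prefix of
  \<open>restr v\<close>, both short enough to lie in the recorded ends. So the local types of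
  \<open>u\<close> and \<open>v\<close> determine the factors of \<open>u @ v\<close>.\<close>

lemma factors_append:
  "factors (u @ v) = factors u \<union> factors v \<union>
     {f. length f = Suc (2 * d) \<and>
         sublist f (rev (take (Suc (2 * d)) (rev (restr u))) @ take (Suc (2 * d)) (restr v))}"
    (is "_ = _ \<union> {f. _ \<and> sublist f (?s @ ?p)}")
proof -
  have s: "suffix ?s (restr u)"
    unfolding suffix_to_prefix rev_rev_ident by (rule take_is_prefix)
  have p: "prefix ?p (restr v)" by (rule take_is_prefix)
  have mono: "sublist (?s @ ?p) (restr u @ restr v)"
  proof -
    obtain a b where "restr u = a @ ?s" "restr v = ?p @ b"
      using s p unfolding suffix_def prefix_def by blast
    then have "restr u @ restr v = a @ (?s @ ?p) @ b" by (metis append.assoc)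
    then show ?thesis unfolding sublist_def by blast
  qed
  have sp: "sublist (f1 @ f2) (?s @ ?p)"
    if len: "length (f1 @ f2) = Suc (2 * d)" and f1: "suffix f1 (restr u)" and f2: "prefix f2 (restr v)"
    for f1 f2
  proof -
    have "suffix f1 ?s"
    proof (rule suffix_length_suffix[OF f1 s])
      show "length f1 \<le> length ?s" using len suffix_length_le[OF f1] by simp
    qed
    moreover have "prefix f2 ?p"
    proof (rule prefix_length_prefix[OF f2 p])
      show "length f2 \<le> length ?p" using len prefix_length_le[OF f2] by simp
    qed
    ultimately show ?thesis unfolding sublist_append by blast
  qed
  have "sublist f (restr u @ restr v) \<longleftrightarrow>
      sublist f (restr u) \<or> sublist f (restr v) \<or> sublist f (?s @ ?p)"
    if len: "length f = Suc (2 * d)" for f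
  proof
    assume "sublist f (restr u @ restr v)"
    then show "sublist f (restr u) \<or> sublist f (restr v) \<or> sublist f (?s @ ?p)"
      unfolding sublist_append[of f "restr u" "restr v"] using sp len by blast
  next
    assume "sublist f (restr u) \<or> sublist f (restr v) \<or> sublist f (?s @ ?p)"
    then show "sublist f (restr u @ restr v)"
      using mono sublist_order.order_trans sublist_append by blast
  qed
  then show ?thesis
    unfolding factors_def map_append by blast
qed

lemma take_append_take: "take n (xs @ ys) = take n (take n xs @ take n ys)"
  by (simp add: min_def)

text \<open>At rank 0 the local type of a concatenation is computed from those of its parts. At
  higher rank a move splits into moves on the two parts, which are answered separately.\<close>

lemma rk_eq_append: "rk_eq k u u' \<Longrightarrow> rk_eq k v v' \<Longrightarrow> rk_eq k (u @ v) (u' @ v')"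
proof (induction k arbitrary: u u' v v')
  case 0
  let ?L = "Suc (2 * d)"
  have u: "take ?L (restr u) = take ?L (restr u')" "take ?L (rev (restr u)) = take ?L (rev (restr u'))"
      "factors u = factors u'"
    and v: "take ?L (restr v) = take ?L (restr v')" "take ?L (rev (restr v)) = take ?L (rev (restr v'))"
      "factors v = factors v'"
    using 0 by (simp_all only: rk_eq.simps local_type_def prod.inject)
  have "take ?L (restr (u @ v)) = take ?L (restr (u' @ v'))"
    using take_append_take[of ?L "restr u" "restr v"] take_append_take[of ?L "restr u'" "restr v'"] u v
    by (simp only: map_append)
  moreover have "take ?L (rev (restr (u @ v))) = take ?L (rev (restr (u' @ v')))"
    using take_append_take[of ?L "rev (restr v)" "rev (restr u)"]
      take_append_take[of ?L "rev (restr v')" "rev (restr u')"] u v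
    by (simp only: map_append rev_append)
  moreover have "factors (u @ v) = factors (u' @ v')"
    using u v by (simp only: factors_append)
  ultimately show ?case by (simp only: rk_eq.simps local_type_def)
next
  case (Suc k)
  show ?case
  proof (rule rk_eq_SucI)
    show "rk_eq k (u @ v) (u' @ v')" using Suc by simp
  next
    fix n z assume n: "n < N" and "variant n (u @ v) z"
    then obtain x y where z: "z = x @ y" "variant n u x" "variant n v y"
      by (auto simp: variant_append)
    obtain x' where "variant n u' x'" "rk_eq k x x'"
      using rk_eq_SucD[OF Suc.prems(1) n z(2)] .
    moreover obtain y' where "variant n v' y'" "rk_eq k y y'"
      using rk_eq_SucD[OF Suc.prems(2) n z(3)] .
    ultimately show "\<exists>z'. variant n (u' @ v') z' \<and> rk_eq k z z'"
      using z Suc.IH variant_append by blast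
  next
    fix n z assume n: "n < N" and "variant n (u' @ v') z"
    then obtain x y where z: "z = x @ y" "variant n u' x" "variant n v' y"
      by (auto simp: variant_append)
    obtain x' where "variant n u x'" "rk_eq k x x'"
      using rk_eq_SucD[OF rk_eq_sym[OF Suc.prems(1)] n z(2)] .
    moreover obtain y' where "variant n v y'" "rk_eq k y y'"
      using rk_eq_SucD[OF rk_eq_sym[OF Suc.prems(2)] n z(3)] .
    ultimately show "\<exists>z'. variant n (u @ v) z' \<and> rk_eq k z' z"
      using z Suc.IH variant_append rk_eq_sym by blast
  qed
qed

end


section \<open>Factorizations of infinite words\<close>

text \<open>The Boolean parameter is the reading direction: \<open>True\<close> stands for the shift, \<open>False\<close>
  for its inverse, for which all blocks are read backwards.\<close>

definition block :: "bool \<Rightarrow> (nat \<Rightarrow> letter) \<Rightarrow> nat \<Rightarrow> nat \<Rightarrow> letter list" where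
  "block D w a b = (if D then map w [a..<b] else rev (map w [a..<b]))"

text \<open>The place in the infinite word of letter \<open>j\<close> of a block. Read backwards, a
  block begins at \<open>b - 1\<close>, hence \<open>b - Suc j\<close>.\<close>

definition pos :: "bool \<Rightarrow> nat \<Rightarrow> nat \<Rightarrow> nat \<Rightarrow> nat" where
  "pos D a b j = (if D then a + j else b - Suc j)"

lemma length_block [simp]: "length (block D w a b) = b - a"
  by (simp add: block_def)

lemma nth_block: "j < b - a \<Longrightarrow> block D w a b ! j = w (pos D a b j)"
  by (auto simp: block_def pos_def rev_nth intro!: arg_cong[of _ _ w])

lemma block_append:
  assumes "a \<le> b" "b \<le> c"
  shows "block D w a c = (if D then block D w a b @ block D w b c else block D w b c @ block D w a b)"
proof -
  have "[a..<c] = [a..<b] @ [b..<c]"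
    using assms by (metis le_add_diff_inverse upt_add_eq_append)
  then show ?thesis by (simp add: block_def)
qed

lemma variant_block:
  assumes "\<And>i. w' i - {n} = w i - {n}"
  shows "variant n (block D w a b) (block D w' a b)"
  unfolding variant_def list_all2_conv_all_nth using assms by (simp add: nth_block)

lemma variant_block_lift:
  assumes "variant n (block D w a b) c"
  obtains w' where "\<And>i. w' i - {n} = w i - {n}" "block D w' a b = c"
proof -
  \<comment> \<open>The index into \<open>c\<close> inverts \<open>pos D a b\<close>; outside the
    block \<open>w\<close> is kept.\<close>
  define w' where "w' i = (if a \<le> i \<and> i < b then c ! (if D then i - a else b - Suc i) else w i)" for i
  have len: "length c = b - a"
    and c: "\<And>j. j < b - a \<Longrightarrow> c ! j - {n} = w (pos D a b j) - {n}"
    using assms by (auto simp: variant_def list_all2_conv_all_nth nth_block)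
  have "w' i - {n} = w i - {n}" for i
  proof (cases "a \<le> i \<and> i < b")
    case True
    then have "(if D then i - a else b - Suc i) < b - a"
      "pos D a b (if D then i - a else b - Suc i) = i" by (auto simp: pos_def)
    then show ?thesis using c True unfolding w'_def by metis
  qed (auto simp: w'_def)
  moreover have "block D w' a b = c"
  proof (rule nth_equalityI)
    fix j assume "j < length (block D w' a b)"
    then have j: "j < b - a" by simp
    then show "block D w' a b ! j = c ! j"
      by (auto simp: nth_block w'_def pos_def)
  qed (simp add: len)
  ultimately show thesis by (rule that)
qed

lemma block_cong: "(\<And>i. a \<le> i \<Longrightarrow> i < b \<Longrightarrow> w i = w' i) \<Longrightarrow> block D w a b = block D w' a b"
  by (simp add: block_def)

section \<open>Ramsey factorizations and the back-and-forth step\<close>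

context
  fixes d N :: nat
begin

text \<open>\<open>e\<close> represents an idempotent of the finite semigroup of words modulo
  \<open>rk_eq\<close>. The letters before \<open>h 0\<close> are left free, as finitely many
  positions do not matter modulo Fin.\<close>

definition fact_by :: "nat \<Rightarrow> bool \<Rightarrow> (nat \<Rightarrow> letter) \<Rightarrow> letter list \<Rightarrow> (nat \<Rightarrow> nat) \<Rightarrow> bool" where
  "fact_by k D w e h \<longleftrightarrow> strict_mono h \<and> rk_eq d N k (e @ e) e \<and>
     (\<forall>j. rk_eq d N k (block D w (h j) (h (Suc j))) e)"

lemma fact_by_merge:
  assumes "fact_by k D w e h" "i < j"
  shows "rk_eq d N k (block D w (h i) (h j)) e"
  using assms(2)
proof (induction j)
  case (Suc j)
  have h: "strict_mono h" and e: "rk_eq d N k (e @ e) e"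
    and b: "rk_eq d N k (block D w (h j) (h (Suc j))) e"
    using assms(1) by (auto simp: fact_by_def)
  show ?case
  proof (cases "i = j")
    case False
    then have ij: "rk_eq d N k (block D w (h i) (h j)) e" using Suc by simp
    have le: "h i \<le> h j" "h j \<le> h (Suc j)" using Suc.prems h by (simp_all add: strict_mono_less_eq)
    \<comment> \<open>Read backwards, the later block comes first, so both orders of concatenation
      are supplied.\<close>
    have "rk_eq d N k (block D w (h i) (h (Suc j))) (e @ e)"
      using rk_eq_append[OF ij b] rk_eq_append[OF b ij]
      by (simp only: block_append[OF le] split: if_split) blast
    then show ?thesis using e rk_eq_trans by blast
  qed (use b in simp)
qed simp

text \<open>Pairs are coloured by the class of the block between their cut points. On a homogeneous
  set all blocks share one class, which is idempotent because two adjacent blocks form a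
  third.\<close>

lemma ramsey_fact_by:
  assumes h: "strict_mono (h :: nat \<Rightarrow> nat)"
  obtains g where "strict_mono g"
    "fact_by k D w (block D w (h (g 0)) (h (g (Suc 0)))) (h \<circ> g)"
proof -
  let ?c = "\<lambda>i j. Collect (rk_eq d N k (block D w (h i) (h j)))"
  let ?C = "range (\<lambda>u. Collect (rk_eq d N k u))"
  \<comment> \<open>The classes are numbered because the colours of \<open>Ramsey2\<close> are
    natural numbers below \<open>s\<close>.\<close>
  obtain idx :: "letter list set \<Rightarrow> nat" and s where idx: "inj_on idx ?C" "idx ` ?C = {..<s}"
    using finite_imp_inj_to_nat_seg[OF finite_classes[of d N k]]
    by (auto simp: lessThan_def)
  have "\<forall>x\<in>UNIV. \<forall>y\<in>UNIV. x \<noteq> y \<longrightarrow> idx (?c (Min {x, y}) (Max {x, y})) < s"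
    using idx(2) by blast
  then obtain Y t where Y: "infinite Y" "\<forall>x\<in>Y. \<forall>y\<in>Y. x \<noteq> y \<longrightarrow> idx (?c (Min {x, y}) (Max {x, y})) = t"
    using Ramsey2[OF infinite_UNIV_nat, of "\<lambda>X. idx (?c (Min X) (Max X))" s] by auto
  define g where "g = enumerate Y"
  have g: "strict_mono g" "\<And>i. g i \<in> Y"
    using Y(1) by (simp_all add: g_def strict_mono_enumerate enumerate_in_set)
  have t: "idx (?c (g i) (g j)) = t" if "i < j" for i j
  proof -
    have "g i < g j" using g(1) that by (simp add: strict_mono_less)
    then show ?thesis using Y(2) g(2)[of i] g(2)[of j] by (force simp: min_def max_def)
  qed
  have hom: "rk_eq d N k (block D w (h (g i)) (h (g j))) (block D w (h (g i')) (h (g j')))"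
    if "i < j" "i' < j'" for i j i' j'
    using inj_onD[OF idx(1), of "?c (g i) (g j)" "?c (g i') (g j')"] t that Collect_rk_eq_iff by auto
  let ?f = "block D w (h (g 0)) (h (g (Suc 0)))"
  have hg: "strict_mono (h \<circ> g)" using h g(1) by (simp add: strict_mono_def)
  have "rk_eq d N k (?f @ ?f) (block D w (h (g 0)) (h (g 2)))"
  proof -
    have le: "h (g 0) \<le> h (g (Suc 0))" "h (g (Suc 0)) \<le> h (g 2)"
      using hg by (simp_all add: strict_mono_def less_imp_le)
    have B: "rk_eq d N k ?f (block D w (h (g (Suc 0))) (h (g 2)))"
      by (rule hom) simp_all
    have f: "rk_eq d N k ?f ?f" by (rule rk_eq_refl)
    show ?thesis
      using rk_eq_append[OF f B] rk_eq_append[OF B f]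
      by (simp only: block_append[OF le] split: if_split) blast
  qed
  also have "rk_eq d N k \<dots> ?f" by (rule hom) auto
  finally show thesis using that[OF g(1)] hg hom by (simp add: fact_by_def)
qed

text \<open>The group \<open>?u\<close> of \<open>w\<close> and every block of \<open>v\<close> have
  class \<open>e\<close> at rank \<open>Suc k\<close>, so the move from \<open>?u\<close> to
  \<open>?f\<close> can be answered in each block of \<open>v\<close>. All answers imitate this one
  group, so \<open>v\<close> keeps its cut points \<open>h'\<close>.\<close>

lemma fact_by_extend:
  assumes w: "fact_by (Suc k) D w e h" and v: "fact_by (Suc k) D' v e h'"
    and n: "n < N" and w': "\<And>i. w' i - {n} = w i - {n}"
  obtains f g g' v' where "fact_by k D w' f g" "fact_by k D' v' f g'"
    "\<And>i. v' i - {n} = v i - {n}"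
proof -
  have h: "strict_mono h" and h': "strict_mono h'"
    using w v by (simp_all add: fact_by_def)
  obtain g where g: "strict_mono g"
      and fg: "fact_by k D w' (block D w' (h (g 0)) (h (g (Suc 0)))) (h \<circ> g)"
    using ramsey_fact_by[OF h] .
  let ?f = "block D w' (h (g 0)) (h (g (Suc 0)))"
  let ?u = "block D w (h (g 0)) (h (g (Suc 0)))"
  have "g 0 < g (Suc 0)" using g by (rule strict_monoD) simp
  then have u: "rk_eq d N (Suc k) ?u e" by (rule fact_by_merge[OF w])
  have "\<exists>x. (\<forall>i. x i - {n} = v i - {n}) \<and> rk_eq d N k ?f (block D' x (h' j) (h' (Suc j)))" for j
  proof -
    have "rk_eq d N (Suc k) (block D' v (h' j) (h' (Suc j))) e"
      using v unfolding fact_by_def by blast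
    then have uv: "rk_eq d N (Suc k) ?u (block D' v (h' j) (h' (Suc j)))"
      by (rule rk_eq_trans[OF u rk_eq_sym])
    obtain c where c: "variant n (block D' v (h' j) (h' (Suc j))) c" "rk_eq d N k ?f c"
      using rk_eq_SucD[OF uv n variant_block[OF w']] .
    obtain x where "\<And>i. x i - {n} = v i - {n}" "block D' x (h' j) (h' (Suc j)) = c"
      using variant_block_lift[OF c(1)] by blast
    then show ?thesis using c(2) by blast
  qed
  then have "\<exists>x. \<forall>j. (\<forall>i. x j i - {n} = v i - {n}) \<and>
      rk_eq d N k ?f (block D' (x j) (h' j) (h' (Suc j)))"
    by (intro choice allI)
  then obtain x where x: "\<And>j i. x j i - {n} = v i - {n}"
      "\<And>j. rk_eq d N k ?f (block D' (x j) (h' j) (h' (Suc j)))" by blast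
  \<comment> \<open>The least such \<open>j\<close> is the number of the block containing
    \<open>i\<close>. Positions before \<open>h' 0\<close> follow \<open>x 0\<close>, which also
    agrees with \<open>v\<close> off \<open>n\<close>.\<close>
  define v' where "v' i = x (LEAST j. i < h' (Suc j)) i" for i
  have v': "block D' v' (h' j) (h' (Suc j)) = block D' (x j) (h' j) (h' (Suc j))" for j
  proof (rule block_cong)
    fix i assume i: "h' j \<le> i" "i < h' (Suc j)"
    have "(LEAST j. i < h' (Suc j)) = j"
    proof (rule Least_equality)
      fix j' assume "i < h' (Suc j')"
      then have "h' j < h' (Suc j')" using i by simp
      then show "j \<le> j'" unfolding strict_mono_less[OF h'] by simp
    qed (rule i)
    then show "v' i = x j i" by (simp add: v'_def)
  qed
  have "rk_eq d N k (?f @ ?f) ?f" using fg unfolding fact_by_def by (rule conjunct1[OF conjunct2])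
  moreover have "rk_eq d N k (block D' v' (h' j) (h' (Suc j))) ?f" for j
    unfolding v' by (rule rk_eq_sym[OF x(2)])
  ultimately have "fact_by k D' v' ?f h'"
    unfolding fact_by_def using h' by blast
  moreover have "v' i - {n} = v i - {n}" for i by (simp add: v'_def x(1))
  ultimately show thesis using that[OF fg] by blast
qed

end


section \<open>Evaluation of terms in windows\<close>

abbreviation aut :: "bool \<Rightarrow> pomega_fin \<Rightarrow> pomega_fin" where
  "aut D \<equiv> (if D then shift else inv shift)"

definition env :: "(nat \<Rightarrow> letter) \<Rightarrow> nat \<Rightarrow> pomega_fin" where
  "env w n = cls {i. n \<in> w i}"

text \<open>Evaluation on representatives. At position 0 truncated subtraction reads 0 again, an
  error confined to one position and so invisible modulo Fin.\<close>

fun point_val :: "bool \<Rightarrow> (nat \<Rightarrow> letter) \<Rightarrow> nat \<Rightarrow> tm \<Rightarrow> bool" where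
  "point_val D w i (Var n) \<longleftrightarrow> n \<in> w i"
| "point_val D w i Zero \<longleftrightarrow> False"
| "point_val D w i One \<longleftrightarrow> True"
| "point_val D w i (Join s t) \<longleftrightarrow> point_val D w i s \<or> point_val D w i t"
| "point_val D w i (Meet s t) \<longleftrightarrow> point_val D w i s \<and> point_val D w i t"
| "point_val D w i (Diff s t) \<longleftrightarrow> point_val D w i s \<and> \<not> point_val D w i t"
| "point_val D w i (Aut t) \<longleftrightarrow> point_val D w (if D then i - 1 else Suc i) t"
| "point_val D w i (AutInv t) \<longleftrightarrow> point_val D w (if D then Suc i else i - 1) t"

text \<open>No direction occurs here: a block for the inverse shift is already reversed, so
  \<open>Aut\<close> always looks one letter to the left.\<close>

fun window_val :: "letter list \<Rightarrow> nat \<Rightarrow> tm \<Rightarrow> bool" where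
  "window_val u j (Var n) \<longleftrightarrow> n \<in> u ! j"
| "window_val u j Zero \<longleftrightarrow> False"
| "window_val u j One \<longleftrightarrow> True"
| "window_val u j (Join s t) \<longleftrightarrow> window_val u j s \<or> window_val u j t"
| "window_val u j (Meet s t) \<longleftrightarrow> window_val u j s \<and> window_val u j t"
| "window_val u j (Diff s t) \<longleftrightarrow> window_val u j s \<and> \<not> window_val u j t"
| "window_val u j (Aut t) \<longleftrightarrow> window_val u (j - 1) t"
| "window_val u j (AutInv t) \<longleftrightarrow> window_val u (Suc j) t"

lemma shift_cls: "shift (cls A) = cls {i. i - 1 \<in> A}"
  unfolding shift.abs_eq pomega_fin.abs_eq_iff almost_eq_def
proof (rule finite_subset[of _ "{0}"])
  show "Suc ` A - {i. i - 1 \<in> A} \<union> ({i. i - 1 \<in> A} - Suc ` A) \<subseteq> {0}"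
  proof
    fix i assume "i \<in> Suc ` A - {i. i - 1 \<in> A} \<union> ({i. i - 1 \<in> A} - Suc ` A)"
    then show "i \<in> {0}" by (cases i) auto
  qed
qed simp

lemma inv_inv_shift: "inv (inv shift) = shift"
  using bij_shift by (rule inv_inv_eq)

lemma tm_val_env: "tm_val (aut D) (env w) t = cls {i. point_val D w i t}"
proof (induction t)
  case (Join s t)
  then show ?case by (simp add: sup_pomega_fin.abs_eq Collect_disj_eq)
next
  case (Meet s t)
  then show ?case by (simp add: inf_pomega_fin.abs_eq Collect_conj_eq)
next
  case (Diff s t)
  then show ?case by (simp add: minus_pomega_fin.abs_eq set_diff_eq)
next
  case (Aut t)
  then show ?case by (simp add: shift_cls inv_shift_cls vimage_def)
next
  case (AutInv t)
  then show ?case by (simp add: shift_cls inv_shift_cls vimage_def inv_inv_shift)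
qed (simp_all add: env_def bot_pomega_fin_def top_pomega_fin_def)

text \<open>From index \<open>j\<close> a term reaches at most \<open>depth t\<close> letters to
  either side, and the hypotheses keep these inside the block.\<close>

lemma point_val_eq_window_val:
  "depth t \<le> j \<Longrightarrow> j + depth t < b - a \<Longrightarrow>
   point_val D w (pos D a b j) t \<longleftrightarrow> window_val (block D w a b) j t"
proof (induction t arbitrary: j)
  case (Aut t)
  then have "(if D then pos D a b j - 1 else Suc (pos D a b j)) = pos D a b (j - 1)"
    by (auto simp: pos_def)
  then show ?case using Aut by simp
next
  case (AutInv t)
  then have "(if D then Suc (pos D a b j) else pos D a b j - 1) = pos D a b (Suc j)"
    by (auto simp: pos_def)
  then show ?case using AutInv by simp
qed (auto simp: nth_block)

lemma window_val_restr:
  "depth t \<le> j \<Longrightarrow> j + depth t < length u \<Longrightarrow> tm_vars t \<subseteq> {..<N} \<Longrightarrow>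
   window_val (map (\<lambda>a. a \<inter> {..<N}) u) j t \<longleftrightarrow> window_val u j t"
  by (induction t arbitrary: j) auto

section \<open>Windows, recurrence of factors and transfer of formulas\<close>

context
  fixes d N :: nat
begin

text \<open>For \<open>d \<le> i\<close> this has length \<open>Suc (2 * d)\<close>, and position
  \<open>i\<close> sits at index \<open>d\<close> in both directions.\<close>

definition window :: "bool \<Rightarrow> (nat \<Rightarrow> letter) \<Rightarrow> nat \<Rightarrow> letter list" where
  "window D w i = map (\<lambda>a. a \<inter> {..<N}) (block D w (i - d) (i + Suc d))"

lemma point_val_window:
  assumes "depth t \<le> d" "tm_vars t \<subseteq> {..<N}" "d \<le> i"
  shows "point_val D w i t \<longleftrightarrow> window_val (window D w i) d t"
proof -
  have "pos D (i - d) (i + Suc d) d = i" using assms(3) by (simp add: pos_def)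
  then have "point_val D w i t \<longleftrightarrow> window_val (block D w (i - d) (i + Suc d)) d t"
    using point_val_eq_window_val[of t d "i + Suc d" "i - d" D w] assms(1,3) by simp
  also have "\<dots> \<longleftrightarrow> window_val (window D w i) d t"
    unfolding window_def by (rule window_val_restr[symmetric]) (use assms in auto)
  finally show ?thesis .
qed

lemma sublist_block:
  assumes "a \<le> a'" "a' \<le> b'" "b' \<le> b"
  shows "sublist (block D w a' b') (block D w a b)"
proof -
  have "sublist (block D w a' b') (block D w a b')"
    using block_append[of a a' b' D w] assms by (auto simp: sublist_append_leftI sublist_append_rightI)
  also have "sublist \<dots> (block D w a b)"
    using block_append[of a b' b D w] assms by (auto simp: sublist_append_leftI sublist_append_rightI)
  finally show ?thesis .
qed

lemma window_in_factors:
  assumes w: "fact_by d N k D w e h" and i: "h 0 + d \<le> i"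
  shows "window D w i \<in> factors d N e"
proof -
  have h: "strict_mono h" using w by (simp add: fact_by_def)
  \<comment> \<open>Since \<open>m \<le> h m\<close>, the merged block from \<open>h 0\<close> to
    \<open>h m\<close> covers the window; also \<open>0 < m\<close>, as merging requires.\<close>
  define m where "m = i + Suc d"
  have "m \<le> h m" using h by (rule strict_mono_imp_increasing)
  then have "sublist (block D w (i - d) (i + Suc d)) (block D w (h 0) (h m))"
    using i by (intro sublist_block) (auto simp: m_def)
  then have "window D w i \<in> factors d N (block D w (h 0) (h m))"
    using i by (simp add: factors_def window_def map_mono_sublist)
  also have "\<dots> = factors d N e"
    using rk_eq_imp_local_type[OF fact_by_merge[OF w, of 0 m]] by (simp add: local_type_def m_def)
  finally show ?thesis .
qed

text \<open>Every block contains all factors of \<open>e\<close>, and block number \<open>m\<close>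
  begins no earlier than \<open>m\<close>.\<close>

lemma factor_recurs:
  assumes w: "fact_by d N k D w e h" and f: "f \<in> factors d N e"
  obtains i where "m \<le> i" "d \<le> i" "window D w i = f"
proof -
  have h: "strict_mono h" using w by (simp add: fact_by_def)
  let ?a = "h m" and ?b = "h (Suc m)"
  have m: "m \<le> ?a" using h by (rule strict_mono_imp_increasing)
  have "factors d N (block D w ?a ?b) = factors d N e"
    using rk_eq_imp_local_type[OF fact_by_merge[OF w, of m "Suc m"]] by (simp add: local_type_def)
  then have len: "length f = Suc (2 * d)"
      and sub: "sublist f (map (\<lambda>a. a \<inter> {..<N}) (block D w ?a ?b))"
    using f by (auto simp: factors_def)
  obtain p q where pq: "map (\<lambda>a. a \<inter> {..<N}) (block D w ?a ?b) = p @ f @ q"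
    using sub by (auto simp: sublist_def)
  have tot: "length p + Suc (2 * d) + length q = ?b - ?a"
    using arg_cong[OF pq, of length] len by simp
  \<comment> \<open>The occurrence starts after \<open>p\<close>, so its centre has index
    \<open>length p + d\<close> in the block.\<close>
  define i where "i = pos D ?a ?b (length p + d)"
  have i: "?a + d \<le> i" using tot by (auto simp: i_def pos_def)
  have "window D w i = f"
  proof (rule nth_equalityI)
    show "length (window D w i) = length f" using len i by (simp add: window_def)
  next
    fix j assume "j < length (window D w i)"
    then have j: "j < Suc (2 * d)" using i by (simp add: window_def)
    have "f ! j = (p @ f @ q) ! (length p + j)" using j len by (simp add: nth_append)
    also have "\<dots> = w (pos D ?a ?b (length p + j)) \<inter> {..<N}"
      unfolding pq[symmetric] using j tot by (simp add: nth_block)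
    also have "pos D ?a ?b (length p + j) = pos D (i - d) (i + Suc d) j"
      using i j tot by (auto simp: i_def pos_def)
    also have "w \<dots> \<inter> {..<N} = window D w i ! j"
      using i j by (simp add: window_def nth_block)
    finally show "window D w i ! j = f ! j" by simp
  qed
  then show thesis using that[of i] i m by simp
qed

text \<open>An exceptional position of \<open>v\<close> beyond \<open>h' 0 + d\<close> would have a
  factor of \<open>e\<close> as its window; this recurs arbitrarily late in \<open>w\<close> and
  would make the exceptions there infinite.\<close>

lemma finite_window_transfer:
  assumes w: "fact_by d N k D w e h" and v: "fact_by d N k D' v e h'"
    and fin: "finite {i. P D w i}"
    and P: "\<And>D w i. d \<le> i \<Longrightarrow> P D w i \<longleftrightarrow> Q (window D w i)"
  shows "finite {i. P D' v i}"
proof (rule finite_subset)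
  show "{i. P D' v i} \<subseteq> {..<h' 0 + d}"
  proof
    fix i assume "i \<in> {i. P D' v i}"
    moreover
    have "\<not> P D' v i" if i: "h' 0 + d \<le> i"
    proof
      assume "P D' v i"
      then have Q: "Q (window D' v i)" using P i by simp
      obtain m where m: "{i. P D w i} \<subseteq> {..<m}" using fin finite_nat_iff_bounded by blast
      obtain i' where "m \<le> i'" "d \<le> i'" "window D w i' = window D' v i"
        using factor_recurs[OF w window_in_factors[OF v i], of m] .
      then show False using Q P m by fastforce
    qed
    ultimately show "i \<in> {..<h' 0 + d}" by force
  qed
qed simp

text \<open>An atomic formula says that the positions violating it are finite in number, which
  windows decide; a quantifier costs one round of the game.\<close>

lemma sat_transfer:
  assumes "fact_by d N k D w e h" "fact_by d N k D' v e h'" "bounded_fm d N k p"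
  shows "sat (aut D) (env w) p \<longleftrightarrow> sat (aut D') (env v) p"
  using assms
proof (induction p arbitrary: k D w D' v e h h')
  case (Eq s t)
  let ?P = "\<lambda>D w i. point_val D w i s \<noteq> point_val D w i t"
  let ?Q = "\<lambda>f. window_val f d s \<noteq> window_val f d t"
  have sat: "sat (aut D) (env w) (Eq s t) \<longleftrightarrow> finite {i. ?P D w i}" for D w
  proof -
    have "{i. ?P D w i} = ({i. point_val D w i s} - {i. point_val D w i t}) \<union>
        ({i. point_val D w i t} - {i. point_val D w i s})" by auto
    then show ?thesis by (simp only: sat.simps tm_val_env pomega_fin.abs_eq_iff almost_eq_def)
  qed
  have PQ: "?P D w i \<longleftrightarrow> ?Q (window D w i)" if "d \<le> i" for D w i
    using Eq.prems(3) that by (simp add: point_val_window)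
  have half: "finite {i. ?P D' v i}"
    if "fact_by d N k D w e h" "fact_by d N k D' v e h'" "finite {i. ?P D w i}" for D D' w v h h'
    using that PQ by (rule finite_window_transfer[where P = ?P and Q = ?Q])
  show ?case
    unfolding sat using half[OF Eq.prems(1,2)] half[OF Eq.prems(2,1)] by (rule iffI)
next
  case (Le s t)
  let ?P = "\<lambda>D w i. point_val D w i s \<and> \<not> point_val D w i t"
  let ?Q = "\<lambda>f. window_val f d s \<and> \<not> window_val f d t"
  have sat: "sat (aut D) (env w) (Le s t) \<longleftrightarrow> finite {i. ?P D w i}" for D w
    by (simp only: sat.simps tm_val_env less_eq_pomega_fin.abs_eq set_diff_eq mem_Collect_eq)
  have PQ: "?P D w i \<longleftrightarrow> ?Q (window D w i)" if "d \<le> i" for D w i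
    using Le.prems(3) that by (simp add: point_val_window)
  have half: "finite {i. ?P D' v i}"
    if "fact_by d N k D w e h" "fact_by d N k D' v e h'" "finite {i. ?P D w i}" for D D' w v h h'
    using that PQ by (rule finite_window_transfer[where P = ?P and Q = ?Q])
  show ?case
    unfolding sat using half[OF Le.prems(1,2)] half[OF Le.prems(2,1)] by (rule iffI)
next
  case (Neg p)
  have "bounded_fm d N k p" using Neg.prems(3) by simp
  from Neg.IH[OF Neg.prems(1,2) this] show ?case unfolding sat.simps by (rule arg_cong)
next
  case (Conj p q)
  have "bounded_fm d N k p" "bounded_fm d N k q" using Conj.prems(3) by simp_all
  from Conj.IH(1)[OF Conj.prems(1,2) this(1)] Conj.IH(2)[OF Conj.prems(1,2) this(2)]
  show ?case unfolding sat.simps by (rule arg_cong2)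
next
  case (Exist n p)
  obtain k' where k: "k = Suc k'" and n: "n < N" and p: "bounded_fm d N k' p"
    using Exist.prems(3) by auto
  \<comment> \<open>Directions and words are free in \<open>half\<close>, so exchanging the two
    sides yields the converse.\<close>
  have half: "sat (aut D') (env v) (Exist n p)"
    if w: "fact_by d N k D w e h" and v: "fact_by d N k D' v e h'"
      and s: "sat (aut D) (env w) (Exist n p)" for D D' w v h h'
  proof -
    obtain a where "sat (aut D) ((env w)(n := a)) p" using s unfolding sat.simps by (rule exE)
    moreover have "cls (rep_pomega_fin a) = a" by (rule Quotient_abs_rep[OF Quotient_pomega_fin])
    ultimately obtain X where X: "sat (aut D) ((env w)(n := cls X)) p" by metis
    define w' where "w' i = (if i \<in> X then insert n (w i) else w i - {n})" for i
    have env_w': "env w' = (env w)(n := cls X)"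
      by (auto simp: env_def w'_def fun_eq_iff intro!: arg_cong[of _ _ cls])
    have w': "\<And>i. w' i - {n} = w i - {n}" by (auto simp: w'_def)
    obtain f g g' v' where fg: "fact_by d N k' D w' f g" "fact_by d N k' D' v' f g'"
        and v': "\<And>i. v' i - {n} = v i - {n}"
      by (rule fact_by_extend[OF w[unfolded k] v[unfolded k] n w']) blast
    \<comment> \<open>Only coordinate \<open>n\<close> was changed, so \<open>env v' n\<close> is
      the witness on the other side.\<close>
    have "m \<in> v' i \<longleftrightarrow> m \<in> v i" if "m \<noteq> n" for m i using v'[of i] that by blast
    then have env_v': "env v' = (env v)(n := env v' n)"
      by (auto simp: env_def fun_eq_iff)
    have "sat (aut D) (env w') p" unfolding env_w' by (rule X)
    then have "sat (aut D') (env v') p" by (rule iffD1[OF Exist.IH[OF fg p]])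
    then have "sat (aut D') ((env v)(n := env v' n)) p" by (rule subst[OF env_v'])
    then show ?thesis unfolding sat.simps by (rule exI)
  qed
  show ?case using half[OF Exist.prems(1,2)] half[OF Exist.prems(2,1)] by (rule iffI)
qed

end

theorem theorem12p1: "elementarily_equivalent shift (inv shift)"
  unfolding elementarily_equivalent_def
proof (intro allI impI)
  fix p assume p: "sentence p"
  obtain d N k where bounded: "bounded_fm d N k p" using ex_bounded_fm by blast
  \<comment> \<open>A sentence may be evaluated under any assignment; this word assigns
    \<open>bot\<close> to every variable.\<close>
  let ?w = "\<lambda>_. {} :: letter"
  obtain g :: "nat \<Rightarrow> nat" and e where g: "fact_by d N k True ?w e g"
    by (rule ramsey_fact_by[of id d N k True ?w]) (auto simp: strict_mono_def)
  \<comment> \<open>Reversal fixes constant blocks, so the same cut points and class serve the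
    inverse shift.\<close>
  have "block False ?w a b = block True ?w a b" for a b
    by (simp add: block_def map_replicate_const)
  with g have g': "fact_by d N k False ?w e g" by (simp add: fact_by_def)
  show "holds shift p \<longleftrightarrow> holds (inv shift) p"
    unfolding holds_iff_sat[OF p, where e = "env ?w"] using sat_transfer[OF g g' bounded] by simp
qed

end
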